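(* Consider the treasure hunt problem in the plane with hints that are angles of size at most $\pi$. There exist a deterministic algorithm for the agent (which does not know $D$ or any bound on it) and an absolute constant $C>0$ such that for every real $D>1$, every position of the treasure at distance at most $D$ from the agent's initial position, and every sequence of hints consistent with the treasure's position in which every hint is an angle of size at most $\pi$, the agent finds the treasure after having traveled a total distance at most $C\cdot D$ (i.e., the cost is $O(D)$).
   Context: Treasure hunt model: a mobile agent and an inert treasure are points in the Euclidean plane. The agent has a compass and a measure of length (so it can maintain a Cartesian coordinate system centered at its starting point $O$). Initially the agent is at distance at most $D$ from the treasure, where $D>1$ is unknown to the agent. The agent makes a sequence of moves, each consisting of moving along a straight segment in a chosen direction for a chosen distance. In the beginning and after each move, the agent receives a hint: a closed angular sector with vertex at the agent's current position, of positive angle smaller than $2\pi$, that contains the treasure (hints may be chosen adversarially, subject only to containing the treasure). The agent finds the treasure as soon as it is (at any point of its trajectory) at distance at most $1$ from it. The cost is the worst-case total length of the agent's trajectory until it finds the treasure. *)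

theory Defs
  imports "HOL-Analysis.Analysis"
begin

text \<open>The plane is the type of complex numbers, in the agent's own coordinate system: its starting
  point is \<open>0\<close>, and its compass and measure of length fix the axes and the unit.\<close>

definition sector :: "complex \<Rightarrow> real \<Rightarrow> real \<Rightarrow> complex set" where
  "sector p \<alpha> \<theta> = {p + of_real r * cis \<phi> | r \<phi>. 0 \<le> r \<and> \<alpha> \<le> \<phi> \<and> \<phi> \<le> \<alpha> + \<theta>}"

definition is_angle :: "complex \<Rightarrow> real \<Rightarrow> complex set \<Rightarrow> bool" where
  "is_angle p \<theta> S \<longleftrightarrow> 0 < \<theta> \<and> \<theta> < 2 * pi \<and> (\<exists>\<alpha>. S = sector p \<alpha> \<theta>)"

text \<open>A deterministic algorithm maps the hints received so far (in order of reception) to the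
  displacement of the next move, that is, its direction and its length. The earlier moves and the
  current position are themselves determined by the algorithm and the hints, and so are not
  passed as arguments.\<close>

type_synonym algorithm = "complex set list \<Rightarrow> complex"

text \<open>Below, \<open>h k\<close> is the hint received after \<open>k\<close> moves.\<close>

definition move :: "algorithm \<Rightarrow> (nat \<Rightarrow> complex set) \<Rightarrow> nat \<Rightarrow> complex" where
  "move A h k = A (map h [0..<Suc k])"

definition position :: "algorithm \<Rightarrow> (nat \<Rightarrow> complex set) \<Rightarrow> nat \<Rightarrow> complex" where
  "position A h k = (\<Sum>i<k. move A h i)"

definition consistent_hints ::
  "real \<Rightarrow> algorithm \<Rightarrow> complex \<Rightarrow> (nat \<Rightarrow> complex set) \<Rightarrow> bool" where
  "consistent_hints \<beta> A t h \<longleftrightarrow>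
     (\<forall>k. (\<exists>\<theta>\<le>\<beta>. is_angle (position A h k) \<theta> (h k)) \<and> t \<in> h k)"

text \<open>The treasure may be found in the middle of a move: \<open>q\<close> is a point of the trajectory reached
  during move \<open>k\<close>, and the sum plus \<open>dist (position A h k) q\<close> is the distance travelled
  on reaching it. Although \<open>h\<close> is infinite, only hints received before that moment
  influence the trajectory up to \<open>q\<close>.\<close>

definition finds_within ::
  "algorithm \<Rightarrow> (nat \<Rightarrow> complex set) \<Rightarrow> complex \<Rightarrow> real \<Rightarrow> bool" where
  "finds_within A h t L \<longleftrightarrow>
     (\<exists>k. \<exists>q \<in> closed_segment (position A h k) (position A h (Suc k)).
        dist q t \<le> 1 \<and> (\<Sum>i<k. norm (move A h i)) + dist (position A h k) q \<le> L)"

end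

theory Submission imports Defs begin

text \<open>A hint of size at most \<open>\<pi>\<close> at the agent's position \<open>p\<close> confines the treasure to a half-plane
  through \<open>p\<close>. For \<open>R = 1, 2, 4, \<dots>\<close> the agent assumes that the treasure is within \<open>R\<close> of the origin and
  keeps moving to a discretised Steiner point \<open>2/N \<Sum>\<^sub>u h\<^sub>K(u) u\<close> of the set \<open>K\<close> of remaining positions, where
  \<open>h\<^sub>K\<close> is the support function of \<open>K\<close> and \<open>u\<close> ranges over the \<open>N\<close>-th roots of unity. As \<open>K\<close> shrinks,
  every move is bounded by the decrease of \<open>2/N \<Sum>\<^sub>u h\<^sub>K(u)\<close>, so all these moves together cost \<open>O(R)\<close>,
  however many there are. While every width of \<open>K\<close> exceeds 2, the Steiner point lies so deep in \<open>K\<close> that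
  the next hint lowers some \<open>h\<^sub>K(u)\<close> by a fixed amount. Hence after a number of moves that depends only
  on \<open>R\<close>, some width is at most 2, and one pass along the midline of the corresponding strip comes
  within distance 1 of every point of \<open>K\<close>.\<close>

section \<open>Roots of unity as a finite set of directions\<close>

text \<open>Divisibility of the order by 4 puts \<open>-1\<close> and \<open>\<i>\<close> among the
  directions. The square makes rounding to a direction cost only order \<open>R / m^2\<close>, below
  the depth of order \<open>1 / m\<close> of the Steiner point.\<close>

definition dirs :: "nat \<Rightarrow> complex set" where
  "dirs m = {z. z ^ (4 * m\<^sup>2) = 1}"

text \<open>Inserting \<open>- R\<close> does not change the supremum for nonempty \<open>K \<subseteq> cball 0 R\<close>; it keeps the function
  bounded and monotone when \<open>K\<close> is empty, which happens if the current guess of \<open>R\<close> is too small.\<close>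

definition supp :: "real \<Rightarrow> complex set \<Rightarrow> complex \<Rightarrow> real" where
  "supp R K z = Sup (insert (- R) ((\<lambda>x. inner x z) ` K))"

definition steiner :: "nat \<Rightarrow> real \<Rightarrow> complex set \<Rightarrow> complex" where
  "steiner m R K = (1 / (2 * real m ^ 2)) *\<^sub>R (\<Sum>z\<in>dirs m. supp R K z *\<^sub>R z)"

lemma finite_dirs: "m > 0 \<Longrightarrow> finite (dirs m)"
  unfolding dirs_def by (rule finite_roots_unity) auto

lemma card_dirs: "m > 0 \<Longrightarrow> card (dirs m) = 4 * m\<^sup>2"
  unfolding dirs_def by (rule card_roots_unity_eq) auto

lemma dirs_norm: "m > 0 \<Longrightarrow> z \<in> dirs m \<Longrightarrow> norm z = 1"
  unfolding dirs_def using power_eq_1_iff[of z "4 * m\<^sup>2"] by auto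

lemma dirs_mult: "z \<in> dirs m \<Longrightarrow> w \<in> dirs m \<Longrightarrow> z * w \<in> dirs m"
  by (simp add: dirs_def power_mult_distrib)

lemma dirs_uminus: "z \<in> dirs m \<Longrightarrow> - z \<in> dirs m"
  by (simp add: dirs_def)

lemma dirs_cnj: "z \<in> dirs m \<Longrightarrow> cnj z \<in> dirs m"
  unfolding dirs_def by (metis (mono_tags) complex_cnj_one complex_cnj_power mem_Collect_eq)

lemma dirs_ii: "\<i> \<in> dirs m"
  by (simp add: dirs_def power_mult)

lemma dirs_cis:
  assumes "m > 0"
  shows "cis (2 * pi * real i / (4 * real m ^ 2)) \<in> dirs m"
proof -
  have "cis (2 * pi * real i / (4 * real m ^ 2)) ^ (4 * m\<^sup>2) = cis (real (4 * m\<^sup>2) * (2 * pi * real i / (4 * real m ^ 2)))"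
    by (rule Complex.DeMoivre)
  also have "real (4 * m\<^sup>2) * (2 * pi * real i / (4 * real m ^ 2)) = 2 * pi * real i"
    using assms by simp
  finally show ?thesis
    by (simp add: dirs_def)
qed

lemma norm_cis_diff_le: "norm (cis a - cis b) \<le> \<bar>a - b\<bar>"
proof -
  have "norm (cis a - cis b) = norm (cis (a - b) - 1)"
  proof -
    have "cis a - cis b = cis b * (cis (a - b) - 1)"
      by (simp add: algebra_simps cis_mult)
    then show ?thesis by (simp add: norm_mult)
  qed
  also have "\<dots> \<le> \<bar>a - b\<bar>"
    using dist_exp_i_1[of "a - b"] abs_sin_x_le_abs_x[of "(a - b) / 2"] by (simp add: cis_conv_exp)
  finally show ?thesis .
qed

lemma dirs_dense:
  assumes m: "m > 0" and v: "norm v = 1"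
  obtains u where "u \<in> dirs m" "norm (u - v) \<le> 2 / real m ^ 2"
proof -
  obtain t where t: "0 \<le> t" "t < 2 * pi" "v = cis t"
    using Arg2pi[of v] v by (auto simp: cis_conv_exp is_Arg_def)
  define N where "N = 4 * real m ^ 2"
  have N: "N > 0" using m by (simp add: N_def)
  define x where "x = t * N / (2 * pi)"
  define i where "i = nat \<lfloor>x\<rfloor>"
  have x0: "x \<ge> 0" unfolding x_def using t N by simp
  have i: "real i \<le> x" "x < real i + 1"
    using x0 unfolding i_def by linarith+
  have tx: "t = 2 * pi * x / N"
    unfolding x_def using N by simp
  let ?u = "cis (2 * pi * real i / N)"
  have "norm (?u - v) \<le> \<bar>2 * pi * real i / N - t\<bar>"
    unfolding t(3) by (rule norm_cis_diff_le)
  also have "2 * pi * real i / N - t = (2 * pi / N) * (real i - x)"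
    unfolding tx by (simp add: algebra_simps diff_divide_distrib)
  also have "\<bar>\<dots>\<bar> \<le> (2 * pi / N) * 1"
    unfolding abs_mult using i N by (intro mult_mono) auto
  also have "\<dots> \<le> 8 / N"
    using N pi_less_4 by (simp add: divide_right_mono)
  also have "\<dots> = 2 / real m ^ 2"
    by (simp add: N_def)
  finally show ?thesis
    using that[of ?u] dirs_cis[OF m, of i] unfolding N_def by simp
qed

text \<open>\<open>m\<close> consecutive steps of \<open>2 * pi / (4 * m^2)\<close> span an arc of
  less than \<open>2 / m\<close>. These \<open>m\<close> directions carry the lower bound on the
  depth of the Steiner point.\<close>

lemma dirs_near:
  assumes m: "m > 0" and u: "u \<in> dirs m"
  obtains J where "J \<subseteq> dirs m" "card J = m" "\<And>z. z \<in> J \<Longrightarrow> norm (z - u) \<le> 2 / real m"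
proof -
  define N where "N = 4 * real m ^ 2"
  have N: "N > 0" using m by (simp add: N_def)
  define g where "g i = u * cis (2 * pi * real i / N)" for i
  have u1: "norm u = 1" using dirs_norm[OF m u] .
  have lt: "2 * pi * real i / N \<in> {0..2 / real m}" if "i < m" for i
  proof -
    have "2 * pi * real i / N \<le> 2 * 4 * real m / N"
      using that N pi_less_4 by (intro divide_right_mono mult_mono) auto
    also have "\<dots> = 2 / real m"
      using m by (simp add: N_def power2_eq_square)
    finally show ?thesis using N by auto
  qed
  have inj: "inj_on g {..<m}"
  proof (rule inj_onI)
    fix i j assume ij: "i \<in> {..<m}" "j \<in> {..<m}" "g i = g j"
    have eq: "cis (2 * pi * real i / N) = cis (2 * pi * real j / N)"
      using ij(3) u1 by (auto simp: g_def)
    have b: "2 * pi * real i / N \<in> {0..<2 * pi}" if "i < m" for i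
    proof -
      \<comment> \<open>The index stays below \<open>4 * m^2\<close>, so the angles stay within one
        turn, where \<open>cis\<close> is injective.\<close>
      have "m * 1 \<le> m * m" using m by (intro mult_left_mono) auto
      then have "i < 4 * m\<^sup>2" using that unfolding power2_eq_square by linarith
      then have "real i < real (4 * m\<^sup>2)" by (simp only: of_nat_less_iff)
      then have "real i < N" by (simp add: N_def)
      then show ?thesis using N by (auto simp: field_simps)
    qed
    have "2 * pi * real i / N = 2 * pi * real j / N"
      using eq b[of i] b[of j] ij
        Arg2pi_unique[of 1 "2 * pi * real i / N" "cis (2 * pi * real i / N)"]
        Arg2pi_unique[of 1 "2 * pi * real j / N" "cis (2 * pi * real i / N)"]
      by (simp add: cis_conv_exp)
    then show "i = j" using N by simp
  qed
  show ?thesis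
  proof (rule that[of "g ` {..<m}"])
    show "g ` {..<m} \<subseteq> dirs m"
      unfolding g_def N_def using dirs_mult[OF u dirs_cis[OF m]] by auto
    show "card (g ` {..<m}) = m"
      by (simp add: card_image inj)
    fix z assume "z \<in> g ` {..<m}"
    then obtain i where i: "i < m" "z = g i" by auto
    have "z - u = u * (cis (2 * pi * real i / N) - cis 0)"
      by (simp add: i g_def algebra_simps)
    then have "norm (z - u) = norm (cis (2 * pi * real i / N) - cis 0)"
      by (simp add: norm_mult u1)
    also have "\<dots> \<le> 2 / real m"
      using norm_cis_diff_le[of "2 * pi * real i / N" 0] lt[OF i(1)] by auto
    finally show "norm (z - u) \<le> 2 / real m" .
  qed
qed

text \<open>Rotation by \<open>\<i>\<close> permutes the directions, and the squared components of a
  unit vector along \<open>u\<close> and across it add up to 1. Twice the sum is therefore the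
  number of directions.\<close>

lemma sum_inner_sq:
  assumes m: "m > 0" and u: "u \<in> dirs m"
  shows "(\<Sum>z\<in>dirs m. (inner z u)\<^sup>2) = 2 * real m ^ 2"
proof -
  have bij: "bij_betw (\<lambda>z. \<i> * z) (dirs m) (dirs m)"
    by (rule bij_betwI[where g = "\<lambda>z. - \<i> * z"])
       (auto intro: dirs_mult dirs_uminus dirs_ii simp: mult.assoc[symmetric])
  have "(\<Sum>z\<in>dirs m. (inner z u)\<^sup>2) = (\<Sum>z\<in>dirs m. (inner (\<i> * z) u)\<^sup>2)"
    by (rule sum.reindex_bij_betw[OF bij, symmetric])
  then have "2 * (\<Sum>z\<in>dirs m. (inner z u)\<^sup>2) = (\<Sum>z\<in>dirs m. (inner z u)\<^sup>2 + (inner (\<i> * z) u)\<^sup>2)"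
    by (simp add: sum.distrib)
  also have "\<dots> = (\<Sum>z\<in>dirs m. 1)"
  proof (rule sum.cong[OF refl])
    fix z assume z: "z \<in> dirs m"
    have "(inner z u)\<^sup>2 + (inner (\<i> * z) u)\<^sup>2 = (norm z)\<^sup>2 * (norm u)\<^sup>2"
      unfolding cmod_power2 by (simp add: inner_complex_def power2_eq_square algebra_simps)
    then show "(inner z u)\<^sup>2 + (inner (\<i> * z) u)\<^sup>2 = 1"
      using dirs_norm[OF m] z u by simp
  qed
  finally show ?thesis
    by (simp add: card_dirs[OF m])
qed

section \<open>Elementary properties of the support function\<close>

lemma supp_bdd:
  assumes "K \<subseteq> cball 0 R" "norm z = 1"
  shows "bdd_above (insert (- R) ((\<lambda>x. inner x z) ` K))"
    and "x \<in> K \<Longrightarrow> \<bar>inner x z\<bar> \<le> R"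
proof -
  show *: "\<bar>inner x z\<bar> \<le> R" if "x \<in> K" for x
    using Cauchy_Schwarz_ineq2[of x z] that assms by auto
  show "bdd_above (insert (- R) ((\<lambda>x. inner x z) ` K))"
    using * by (intro bdd_aboveI[of _ "\<bar>R\<bar>"]) fastforce
qed

lemma inner_le_supp:
  assumes "K \<subseteq> cball 0 R" "norm z = 1" "x \<in> K"
  shows "inner x z \<le> supp R K z"
  unfolding supp_def using supp_bdd(1)[OF assms(1,2)] assms(3) by (intro cSup_upper) auto

lemma supp_bounds:
  assumes "K \<subseteq> cball 0 R" "norm z = 1" "R \<ge> 0"
  shows "- R \<le> supp R K z" "supp R K z \<le> R" "\<bar>supp R K z\<bar> \<le> R"
proof -
  show *: "- R \<le> supp R K z"
    unfolding supp_def using supp_bdd(1)[OF assms(1,2)] by (intro cSup_upper) auto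
  show **: "supp R K z \<le> R"
    unfolding supp_def using supp_bdd(2)[OF assms(1,2)] assms(3)
    by (intro cSup_least) (auto simp: abs_le_iff)
  show "\<bar>supp R K z\<bar> \<le> R" using * ** by auto
qed

lemma supp_mono:
  assumes "K \<subseteq> cball 0 R" "norm z = 1" "K' \<subseteq> K"
  shows "supp R K' z \<le> supp R K z"
  unfolding supp_def using supp_bdd(1)[OF assms(1,2)] assms(3) by (intro cSup_subset_mono) auto

lemma supp_least:
  assumes "K \<subseteq> cball 0 R" "norm z = 1" "K \<noteq> {}" "\<And>x. x \<in> K \<Longrightarrow> inner x z \<le> b"
  shows "supp R K z \<le> b"
proof -
  obtain y where y: "y \<in> K" using assms(3) by auto
  \<comment> \<open>The inserted default \<open>- R\<close> must respect the bound too; any point of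
    \<open>K\<close> ensures this.\<close>
  have "- R \<le> b"
    using supp_bdd(2)[OF assms(1,2) y] assms(4)[OF y] by linarith
  then show ?thesis
    unfolding supp_def using assms(4) by (intro cSup_least) auto
qed

lemma supp_lipschitz:
  assumes "K \<subseteq> cball 0 R" "norm z = 1" "norm w = 1" "K \<noteq> {}"
  shows "supp R K z \<le> supp R K w + R * norm (z - w)"
proof (rule supp_least[OF assms(1,2,4)])
  fix x assume x: "x \<in> K"
  have "inner x z = inner x w + inner x (z - w)" by (simp add: inner_diff_right)
  also have "inner x (z - w) \<le> norm x * norm (z - w)" by (rule norm_cauchy_schwarz)
  also have "\<dots> \<le> R * norm (z - w)" using x assms(1) by (intro mult_right_mono) auto
  finally show "inner x z \<le> supp R K w + R * norm (z - w)"
    using inner_le_supp[OF assms(1,3) x] by linarith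
qed

text \<open>Sublinearity of the support function, in the form needed when \<open>z\<close> and
  \<open>w\<close> are mirror images of each other and so differ by a multiple of
  \<open>u\<close>.\<close>

lemma supp_subadd:
  assumes "K \<subseteq> cball 0 R" "norm z = 1" "norm w = 1" "norm u = 1" "K \<noteq> {}"
    and "z = w + (2 * c) *\<^sub>R u" "c \<ge> 0"
  shows "supp R K z \<le> supp R K w + 2 * c * supp R K u"
proof (rule supp_least[OF assms(1,2,5)])
  fix x assume x: "x \<in> K"
  have "inner x z = inner x w + 2 * c * inner x u"
    unfolding assms(6) by (simp add: inner_add_right)
  also have "\<dots> \<le> supp R K w + 2 * c * supp R K u"
    using inner_le_supp[OF assms(1,3) x] inner_le_supp[OF assms(1,4) x] assms(7)
    by (intro add_mono mult_left_mono) auto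
  finally show "inner x z \<le> supp R K w + 2 * c * supp R K u" .
qed

section \<open>Depth of the Steiner point\<close>

text \<open>For a unit vector \<open>u\<close>, this is the reflection in the line through 0
  perpendicular to \<open>u\<close>.\<close>

definition reflect :: "complex \<Rightarrow> complex \<Rightarrow> complex" where
  "reflect u z = z - (2 * inner z u) *\<^sub>R u"

text \<open>In complex form the mirror image is \<open>- (u * u * cnj z)\<close>, and the directions
  are closed under products, conjugation and negation.\<close>

lemma reflect:
  assumes m: "m > 0" and u: "u \<in> dirs m"
  shows "z \<in> dirs m \<Longrightarrow> reflect u z \<in> dirs m"
    and "reflect u (reflect u z) = z"
    and "inner (reflect u z) u = - inner z u"
    and "norm (reflect u z + u) = norm (z - u)"
proof -
  have n: "norm u = 1" using dirs_norm[OF m u] .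
  have iu: "inner u u = 1" using n by (simp add: dot_square_norm)
  have "u * cnj u = 1" using n by (simp add: complex_norm_square[symmetric])
  have "reflect u z = - (u * u * cnj z)"
  proof -
    have "of_real (2 * inner z u) = cnj z * u + z * cnj u"
      by (auto simp: complex_eq_iff inner_complex_def algebra_simps)
    then have "(2 * inner z u) *\<^sub>R u = u * u * cnj z + z * (u * cnj u)"
      unfolding scaleR_conv_of_real by (simp add: algebra_simps)
    then show ?thesis
      unfolding reflect_def \<open>u * cnj u = 1\<close> by simp
  qed
  then show "reflect u z \<in> dirs m" if "z \<in> dirs m"
    using that u by (auto intro!: dirs_uminus dirs_mult dirs_cnj)
  show *: "inner (reflect u z) u = - inner z u" for z
    by (simp add: reflect_def inner_diff_left iu)
  show "reflect u (reflect u z) = z"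
    unfolding reflect_def[of u "reflect u z"] * by (simp add: reflect_def)
  have "(norm (reflect u z + u))\<^sup>2 = (norm (z - u))\<^sup>2"
    unfolding power2_norm_eq_inner reflect_def
    by (simp add: iu inner_commute algebra_simps)
  then show "norm (reflect u z + u) = norm (z - u)"
    by simp
qed

lemma steiner_deep:
  assumes K: "K \<subseteq> cball 0 R" "K \<noteq> {}" and R: "R \<ge> 1" and m: "real m \<ge> 8 * R"
    and u: "u \<in> dirs m" and wide: "supp R K u + supp R K (- u) > 2"
  shows "inner (steiner m R K) u \<le> supp R K u - 1 / (8 * real m)"
proof -
  have m0: "m > 0" using m R by (cases m) auto
  note n = dirs_norm[OF m0]
  let ?h = "supp R K"
  txt \<open>Pairing \<open>z\<close> with its mirror image turns \<open>?h u - inner (steiner m R K) u\<close> into the average of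
    \<open>f\<close>, which is nonnegative by subadditivity of \<open>?h\<close> and at least 1/2 near \<open>u\<close> since \<open>K\<close> is wide.\<close>
  define f where "f z = inner z u * (?h (reflect u z) - ?h z) + 2 * (inner z u)\<^sup>2 * ?h u" for z
  have f0: "f z \<ge> 0" if z: "z \<in> dirs m" for z
  proof (cases "inner z u \<ge> 0")
    case True
    have "?h z \<le> ?h (reflect u z) + 2 * inner z u * ?h u"
      using z u True n reflect[OF m0 u]
      by (intro supp_subadd[OF K(1) _ _ _ K(2)]) (auto simp: reflect_def)
    then have "0 \<le> inner z u * (?h (reflect u z) + 2 * inner z u * ?h u - ?h z)"
      using True by simp
    then show ?thesis by (simp add: f_def power2_eq_square algebra_simps)
  next
    case False
    have "?h (reflect u z) \<le> ?h z + 2 * (- inner z u) * ?h u"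
      using z u False n reflect[OF m0 u]
      by (intro supp_subadd[OF K(1) _ _ _ K(2)]) (auto simp: reflect_def)
    then have "0 \<le> (- inner z u) * (?h z + 2 * (- inner z u) * ?h u - ?h (reflect u z))"
      using False by (intro mult_nonneg_nonneg) auto
    then show ?thesis by (simp add: f_def power2_eq_square algebra_simps)
  qed
  obtain J where J: "J \<subseteq> dirs m" "card J = m" "\<And>z. z \<in> J \<Longrightarrow> norm (z - u) \<le> 2 / real m"
    using dirs_near[OF m0 u] by blast
  have fJ: "f z \<ge> 1 / 2" if zJ: "z \<in> J" for z
  proof -
    have z: "z \<in> dirs m" using J zJ by auto
    define e where "e = norm (z - u)"
    \<comment> \<open>The assumption \<open>real m \<ge> 8 * R\<close> enters here: each replacement
      of a direction by a neighbour changes support values by at most 1/4.\<close>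
    have "R * (2 / real m) \<le> 1 / 4" using m m0 by (simp add: field_simps)
    moreover have "R * e \<le> R * (2 / real m)" using J(3)[OF zJ] R by (intro mult_left_mono) (auto simp: e_def)
    ultimately have Re: "R * e \<le> 1 / 4" by linarith
    have "1 * e \<le> R * e" using R by (intro mult_right_mono) (auto simp: e_def)
    then have e: "0 \<le> e" "e \<le> 1 / 4" using Re by (auto simp: e_def)
    have "inner z u = 1 + inner (z - u) u"
      using n[OF u] by (simp add: inner_diff_left dot_square_norm)
    moreover have "\<bar>inner (z - u) u\<bar> \<le> e"
      using Cauchy_Schwarz_ineq2[of "z - u" u] n[OF u] by (simp add: e_def)
    moreover have "inner z u \<le> 1"
      using norm_cauchy_schwarz[of z u] n z u by simp
    ultimately have c: "1 - e \<le> inner z u" "inner z u \<le> 1" by auto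
    have h1: "?h z \<le> ?h u + R * e"
      unfolding e_def using n z u by (intro supp_lipschitz K) auto
    have h2: "?h (- u) \<le> ?h (reflect u z) + R * e"
    proof -
      have "norm (- u - reflect u z) = e"
        using reflect(4)[OF m0 u, of z] unfolding e_def
        by (metis add_uminus_conv_diff minus_add norm_minus_cancel)
      moreover have "?h (- u) \<le> ?h (reflect u z) + R * norm (- u - reflect u z)"
        using n z u reflect(1)[OF m0 u z] by (intro supp_lipschitz K) auto
      ultimately show ?thesis by simp
    qed
    have "\<bar>(1 - inner z u) * ?h u\<bar> \<le> e * R"
      unfolding abs_mult using c supp_bounds(3)[OF K(1) n[OF u]] R by (intro mult_mono) auto
    then have h3: "inner z u * ?h u \<ge> ?h u - R * e"
      by (simp add: algebra_simps abs_le_iff)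
    \<comment> \<open>The three estimates together lose at most \<open>4 * (R * e)\<close>, hence at
      most 1, from a width that exceeds 2.\<close>
    have "?h (reflect u z) - ?h z + 2 * (inner z u * ?h u) \<ge> 1"
      using h1 h2 h3 Re wide by linarith
    then have "(1 / 2) * 1 \<le> inner z u * (?h (reflect u z) - ?h z + 2 * (inner z u * ?h u))"
      using c e by (intro mult_mono) auto
    then show ?thesis by (simp add: f_def power2_eq_square algebra_simps)
  qed
  have bij: "bij_betw (reflect u) (dirs m) (dirs m)"
    using reflect[OF m0 u] by (intro bij_betwI[where g = "reflect u"]) auto
  \<comment> \<open>The directions in \<open>J\<close> alone contribute \<open>m / 2\<close>. The
    whole sum turns out to be \<open>4 * m^2\<close> times the depth, which gives
    \<open>1 / (8 * m)\<close>.\<close>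
  have "real m / 2 = (\<Sum>z\<in>J. 1 / 2)"
    using J(2) by simp
  also have "\<dots> \<le> (\<Sum>z\<in>J. f z)" by (intro sum_mono fJ)
  also have "\<dots> \<le> (\<Sum>z\<in>dirs m. f z)"
    using J(1) f0 by (intro sum_mono2 finite_dirs m0) auto
  also have "\<dots> = (\<Sum>z\<in>dirs m. inner z u * ?h (reflect u z)) - (\<Sum>z\<in>dirs m. inner z u * ?h z)
      + 2 * ?h u * (\<Sum>z\<in>dirs m. (inner z u)\<^sup>2)"
    unfolding f_def by (simp add: sum.distrib sum_subtractf right_diff_distrib sum_distrib_left mult_ac)
  \<comment> \<open>Reindexing by the reflection undoes it inside \<open>?h\<close> and flips the
    sign of the inner product, so both sums become multiples of the Steiner point's component along
    \<open>u\<close>.\<close>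
  also have "(\<Sum>z\<in>dirs m. inner z u * ?h (reflect u z)) = (\<Sum>z\<in>dirs m. inner (reflect u z) u * ?h (reflect u (reflect u z)))"
    by (rule sum.reindex_bij_betw[OF bij, symmetric])
  also have "\<dots> = - (\<Sum>z\<in>dirs m. inner z u * ?h z)"
    by (simp add: reflect[OF m0 u] sum_negf)
  also have "(\<Sum>z\<in>dirs m. (inner z u)\<^sup>2) = 2 * real m ^ 2"
    by (rule sum_inner_sq[OF m0 u])
  also have "(\<Sum>z\<in>dirs m. inner z u * ?h z) = 2 * real m ^ 2 * inner (steiner m R K) u"
    using m0 by (simp add: steiner_def inner_sum_left mult.commute)
  finally have "real m / 2 \<le> 4 * real m ^ 2 * (?h u - inner (steiner m R K) u)"
    by (simp add: algebra_simps)
  then have "real m * (1 / 2) \<le> real m * (4 * real m * (?h u - inner (steiner m R K) u))"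
    by (simp add: power2_eq_square mult_ac)
  then have "1 / 2 \<le> 4 * real m * (?h u - inner (steiner m R K) u)"
    using m0 by (subst (asm) mult_le_cancel_left_pos) auto
  then have "1 / (8 * real m) \<le> ?h u - inner (steiner m R K) u"
    using m0 by (simp add: field_simps)
  then show ?thesis by simp
qed

section \<open>Effect of shrinking the set on the Steiner point and the support sum\<close>

text \<open>Shrinking lowers every support value, so all differences have one sign. The triangle
  inequality then gives a bound that telescopes along a decreasing chain of sets.\<close>

lemma norm_steiner_diff_le:
  assumes m: "m > 0" and K: "K \<subseteq> cball 0 R" "K' \<subseteq> K"
  shows "norm (steiner m R K' - steiner m R K) \<le>
    ((\<Sum>z\<in>dirs m. supp R K z) - (\<Sum>z\<in>dirs m. supp R K' z)) / (2 * real m ^ 2)"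
proof -
  have "steiner m R K' - steiner m R K =
      (1 / (2 * real m ^ 2)) *\<^sub>R (\<Sum>z\<in>dirs m. (supp R K' z - supp R K z) *\<^sub>R z)"
    by (simp add: steiner_def scaleR_diff_left sum_subtractf scaleR_diff_right)
  also have "norm \<dots> \<le> (1 / (2 * real m ^ 2)) * (\<Sum>z\<in>dirs m. norm ((supp R K' z - supp R K z) *\<^sub>R z))"
    unfolding norm_scaleR using m by (intro mult_mono sum_norm_le) auto
  also have "(\<Sum>z\<in>dirs m. norm ((supp R K' z - supp R K z) *\<^sub>R z)) = (\<Sum>z\<in>dirs m. supp R K z - supp R K' z)"
    using supp_mono[OF K(1) _ K(2)] dirs_norm[OF m] by (intro sum.cong) auto
  finally show ?thesis by (simp add: sum_subtractf)
qed

lemma sum_supp_bounds: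
  assumes m: "m > 0" and K: "K \<subseteq> cball 0 R" and R: "R \<ge> 0"
  shows "\<bar>\<Sum>z\<in>dirs m. supp R K z\<bar> \<le> 4 * real m ^ 2 * R"
proof -
  have "\<bar>\<Sum>z\<in>dirs m. supp R K z\<bar> \<le> (\<Sum>z\<in>dirs m. \<bar>supp R K z\<bar>)" by (rule sum_abs)
  also have "\<dots> \<le> (\<Sum>z\<in>dirs m. R)"
    using supp_bounds(3)[OF K _ R] dirs_norm[OF m] by (intro sum_mono) auto
  finally show ?thesis by (simp add: card_dirs[OF m])
qed

lemma norm_steiner_le:
  assumes m: "m > 0" and K: "K \<subseteq> cball 0 R" and R: "R \<ge> 0"
  shows "norm (steiner m R K) \<le> 2 * R"
proof -
  have "norm (steiner m R K) \<le> (1 / (2 * real m ^ 2)) * (\<Sum>z\<in>dirs m. norm (supp R K z *\<^sub>R z))"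
    unfolding steiner_def norm_scaleR using m by (intro mult_mono sum_norm_le) auto
  also have "\<dots> \<le> (1 / (2 * real m ^ 2)) * (\<Sum>z\<in>dirs m. R)"
    using supp_bounds(3)[OF K _ R] dirs_norm[OF m] by (intro mult_left_mono sum_mono) auto
  also have "\<dots> = 2 * R" using m by (simp add: card_dirs)
  finally show ?thesis .
qed

text \<open>The normal \<open>v\<close> of the cut is rounded to a direction \<open>u\<close>. The
  depth \<open>1 / (8 * m)\<close> pays for the rounding error and leaves half of itself as a drop
  at \<open>u\<close>; no other support value rises.\<close>

lemma steiner_cut:
  assumes K: "K \<subseteq> cball 0 R" and R: "R \<ge> 1" and m: "real m \<ge> 96 * R"
    and wide: "\<And>u. u \<in> dirs m \<Longrightarrow> supp R K u + supp R K (- u) > 2"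
    and K': "K' \<subseteq> K" "K' \<noteq> {}"
    and v: "norm v = 1" "\<And>x. x \<in> K' \<Longrightarrow> inner (x - steiner m R K) v \<le> 0"
  shows "(\<Sum>z\<in>dirs m. supp R K' z) \<le> (\<Sum>z\<in>dirs m. supp R K z) - 1 / (16 * real m)"
proof -
  have m0: "m > 0" using m R by (cases m) auto
  note n = dirs_norm[OF m0]
  obtain u where u: "u \<in> dirs m" "norm (u - v) \<le> 2 / real m ^ 2"
    using dirs_dense[OF m0 v(1)] by blast
  let ?s = "steiner m R K"
  have K'b: "K' \<subseteq> cball 0 R" using K K' by auto
  have deep: "inner ?s u \<le> supp R K u - 1 / (8 * real m)"
    using K K' R m u wide by (intro steiner_deep) auto
  have drop: "supp R K' u \<le> supp R K u - 1 / (16 * real m)"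
  proof (rule supp_least[OF K'b n[OF u(1)] K'(2)])
    fix x assume x: "x \<in> K'"
    have "norm (x - ?s) \<le> norm x + norm ?s" by (rule norm_triangle_ineq4)
    also have "\<dots> \<le> 3 * R" using norm_steiner_le[OF m0 K] x K'b R by auto
    finally have "norm (x - ?s) * norm (u - v) \<le> 3 * R * (2 / real m ^ 2)"
      using u(2) R by (intro mult_mono) auto
    \<comment> \<open>Source of the constant 96: \<open>6 * R / m^2 \<le> 1 / (16 * m)\<close>
      amounts to \<open>m \<ge> 96 * R\<close>.\<close>
    also have "\<dots> \<le> 1 / (16 * real m)"
      using m m0 by (simp add: field_simps power2_eq_square)
    finally have "inner (x - ?s) (u - v) \<le> 1 / (16 * real m)"
      using norm_cauchy_schwarz[of "x - ?s" "u - v"] by linarith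
    moreover have "inner x u = inner ?s u + inner (x - ?s) v + inner (x - ?s) (u - v)"
      by (simp add: inner_diff_left inner_diff_right)
    moreover have "1 / (8 * real m) = 2 * (1 / (16 * real m))" by simp
    ultimately show "inner x u \<le> supp R K u - 1 / (16 * real m)"
      using deep v(2)[OF x] by linarith
  qed
  have "(\<Sum>z\<in>dirs m. supp R K' z) = supp R K' u + (\<Sum>z\<in>dirs m - {u}. supp R K' z)"
    by (rule sum.remove[OF finite_dirs[OF m0] u(1)])
  also have "\<dots> \<le> supp R K u - 1 / (16 * real m) + (\<Sum>z\<in>dirs m - {u}. supp R K z)"
    using supp_mono[OF K _ K'(1)] n by (intro add_mono drop sum_mono) auto
  also have "\<dots> = (\<Sum>z\<in>dirs m. supp R K z) - 1 / (16 * real m)"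
    using sum.remove[OF finite_dirs[OF m0] u(1), of "supp R K"] by simp
  finally show ?thesis .
qed

section \<open>Hints as half-planes, and sweeping a thin set\<close>

text \<open>The outer normal is opposite to the bisector: every ray of the sector makes an angle of
  at most \<open>pi / 2\<close> with the bisector.\<close>

lemma is_angle_half_plane:
  assumes "is_angle p \<theta> S" "\<theta> \<le> pi"
  obtains v where "norm v = 1" "\<And>x. x \<in> S \<Longrightarrow> inner (x - p) v \<le> 0"
proof -
  obtain \<alpha> where S: "S = sector p \<alpha> \<theta>" using assms by (auto simp: is_angle_def)
  show ?thesis
  proof (rule that[of "- cis (\<alpha> + \<theta> / 2)"])
    fix x assume "x \<in> S"
    then obtain r \<phi> where x: "x = p + of_real r * cis \<phi>" "0 \<le> r" "\<alpha> \<le> \<phi>" "\<phi> \<le> \<alpha> + \<theta>"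
      by (auto simp: S sector_def)
    have "inner (x - p) (cis (\<alpha> + \<theta> / 2)) = r * cos (\<phi> - (\<alpha> + \<theta> / 2))"
      by (simp add: x inner_complex_def cos_diff algebra_simps)
    moreover have "cos (\<phi> - (\<alpha> + \<theta> / 2)) \<ge> 0"
      using x assms(2) by (intro cos_ge_zero) (auto simp: field_simps)
    ultimately show "inner (x - p) (- cis (\<alpha> + \<theta> / 2)) \<le> 0"
      using x(2) by simp
  qed simp
qed

definition thin :: "nat \<Rightarrow> real \<Rightarrow> complex set \<Rightarrow> complex \<Rightarrow> bool" where
  "thin m R K u \<longleftrightarrow> u \<in> dirs m \<and> supp R K u + supp R K (- u) \<le> 2"

definition sweep_dir :: "nat \<Rightarrow> real \<Rightarrow> complex set \<Rightarrow> complex" where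
  "sweep_dir m R K = (SOME u. thin m R K u)"

text \<open>The point with coordinate \<open>c\<close> on the midline of the supporting strip of
  \<open>K\<close> perpendicular to \<open>u\<close>.\<close>

definition sweep_end :: "real \<Rightarrow> nat \<Rightarrow> real \<Rightarrow> complex set \<Rightarrow> complex" where
  "sweep_end c m R K = (let u = sweep_dir m R K in
     ((supp R K u - supp R K (- u)) / 2) *\<^sub>R u + c *\<^sub>R (\<i> * u))"

lemma thin_antimono:
  assumes "m > 0" "K \<subseteq> cball 0 R" "K' \<subseteq> K" "thin m R K u"
  shows "thin m R K' u"
  using supp_mono[OF assms(2) _ assms(3), of u] supp_mono[OF assms(2) _ assms(3), of "- u"]
    dirs_norm[OF assms(1), of u] assms(4) by (auto simp: thin_def)

lemma thin_sweep_dir: "\<exists>u. thin m R K u \<Longrightarrow> thin m R K (sweep_dir m R K)"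
  unfolding sweep_dir_def by (rule someI_ex)

lemma norm_sweep_end_le:
  assumes m: "m > 0" and K: "K \<subseteq> cball 0 R" and R: "R \<ge> 0" and thin: "\<exists>u. thin m R K u"
    and c: "\<bar>c\<bar> \<le> R"
  shows "norm (sweep_end c m R K) \<le> 2 * R"
proof -
  define u where "u = sweep_dir m R K"
  have u: "norm u = 1"
    using thin_sweep_dir[OF thin] dirs_norm[OF m] by (auto simp: thin_def u_def)
  have "norm (sweep_end c m R K) \<le> \<bar>(supp R K u - supp R K (- u)) / 2\<bar> + \<bar>c\<bar>"
    unfolding sweep_end_def Let_def u_def[symmetric]
    by (rule norm_triangle_le) (simp add: norm_mult u)
  also have "\<bar>(supp R K u - supp R K (- u)) / 2\<bar> \<le> R"
    using supp_bounds(1,2)[OF K _ R, of u] supp_bounds(1,2)[OF K _ R, of "- u"] u by simp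
  finally show ?thesis using c by simp
qed

text \<open>The orthogonal projection of \<open>x\<close> to the midline serves as \<open>q\<close>:
  its coordinate along the midline is at most \<open>R\<close> in absolute value, and its distance
  from \<open>x\<close> is at most half the strip's width.\<close>

lemma sweep_finds:
  assumes m: "m > 0" and K: "K \<subseteq> cball 0 R" and R: "R \<ge> 0" and thin: "\<exists>u. thin m R K u"
    and x: "x \<in> K"
  obtains q where "q \<in> closed_segment (sweep_end (- R) m R K) (sweep_end R m R K)" "dist q x \<le> 1"
proof -
  define u where "u = sweep_dir m R K"
  have t: "thin m R K u" using thin_sweep_dir[OF thin] by (simp add: u_def)
  then have u: "norm u = 1" using dirs_norm[OF m] by (auto simp: thin_def)
  define mid where "mid = ((supp R K u - supp R K (- u)) / 2) *\<^sub>R u"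
  define c where "c = inner x (\<i> * u)"
  define q where "q = mid + c *\<^sub>R (\<i> * u)"
  have c: "\<bar>c\<bar> \<le> R"
    unfolding c_def using u by (intro supp_bdd(2)[OF K _ x]) (simp add: norm_mult)
  have ends: "sweep_end d m R K = mid + d *\<^sub>R (\<i> * u)" for d
    by (simp add: sweep_end_def mid_def u_def Let_def)
  have "q \<in> closed_segment (sweep_end (- R) m R K) (sweep_end R m R K)"
  proof (cases "R = 0")
    case True
    then show ?thesis using c ends[of 0] by (simp add: q_def)
  next
    case False
    define s where "s = (c + R) / (2 * R)"
    have s: "0 \<le> s" "s \<le> 1" using c False R by (auto simp: s_def field_simps)
    have "c = (1 - s) * (- R) + s * R" using False by (simp add: s_def field_simps)
    then have "q = (1 - s) *\<^sub>R sweep_end (- R) m R K + s *\<^sub>R sweep_end R m R K"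
      unfolding q_def ends by (simp add: algebra_simps flip: scaleR_add_left)
    then show ?thesis using s by (auto simp: in_segment)
  qed
  moreover have "dist q x \<le> 1"
  proof -
    have "x = inner x u *\<^sub>R u + c *\<^sub>R (\<i> * u)"
    proof -
      have "u * cnj u = 1" using u by (simp add: complex_norm_square[symmetric])
      moreover have "inner x u *\<^sub>R u + c *\<^sub>R (\<i> * u) = x * (u * cnj u)"
        unfolding c_def by (simp add: complex_eq_iff inner_complex_def algebra_simps)
      ultimately show ?thesis by simp
    qed
    then have "q - x = ((supp R K u - supp R K (- u)) / 2 - inner x u) *\<^sub>R u"
      unfolding q_def mid_def by (simp add: algebra_simps)
    then have "dist q x = \<bar>(supp R K u - supp R K (- u)) / 2 - inner x u\<bar>"
      by (simp add: dist_norm u)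
    also have "\<dots> \<le> 1"
      using inner_le_supp[OF K _ x, of u] inner_le_supp[OF K _ x, of "- u"] u t
      unfolding thin_def by (simp add: abs_le_iff field_simps)
    finally show ?thesis .
  qed
  ultimately show ?thesis using that by blast
qed

section \<open>Phases and the algorithm\<close>

text \<open>Phase \<open>i\<close>, in which \<open>R = 2 ^ i\<close>, comprises the moves \<open>k\<close> with \<open>start i \<le> k < start (Suc i)\<close>: first
  \<open>steps i\<close> moves to Steiner points, then one move to each end of the midline.\<close>

definition resolution :: "nat \<Rightarrow> nat" where
  "resolution i = 96 * 2 ^ i"

text \<open>With \<open>R = 2 ^ i\<close> and \<open>m = resolution i\<close>, the support sum can
  fall by at most \<open>8 * m^2 * R\<close>, and each cut takes \<open>1 / (16 * m)\<close>. One
  cut more than the quotient \<open>128 * R * m^3\<close> is impossible.\<close>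

definition steps :: "nat \<Rightarrow> nat" where
  "steps i = 128 * 2 ^ i * resolution i ^ 3 + 1"

definition start :: "nat \<Rightarrow> nat" where
  "start i = (\<Sum>j<i. steps j + 2)"

text \<open>Here \<open>n\<close> counts hints, and the target for \<open>n > 0\<close> hints ends
  move \<open>n - 1\<close>. Hence phase \<open>i\<close> covers
  \<open>start i < n \<le> start (Suc i)\<close>, shifted by one against the move numbers.\<close>

definition phase :: "nat \<Rightarrow> nat" where
  "phase n = (LEAST i. n \<le> start (Suc i))"

definition region :: "nat \<Rightarrow> complex set list \<Rightarrow> complex set" where
  "region i hs = cball 0 (2 ^ i) \<inter> \<Inter> (set hs)"

text \<open>The last case drops the newest hint so that both ends of the sweep come from the same
  region and the same choice of \<open>sweep_dir\<close>.\<close>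

definition target :: "complex set list \<Rightarrow> complex" where
  "target hs = (if hs = [] then 0 else
     let i = phase (length hs); m = resolution i; R = 2 ^ i; j = length hs - start i in
       if j \<le> steps i then steiner m R (region i hs)
       else if j = steps i + 1 then sweep_end (- R) m R (region i hs)
       else sweep_end R m R (region i (butlast hs)))"

definition hunt :: algorithm where
  "hunt hs = target hs - target (butlast hs)"

lemma resolution_pos: "resolution i > 0"
  by (simp add: resolution_def)

lemma start_Suc: "start (Suc i) = start i + steps i + 2"
  by (simp add: start_def)

lemma start_mono: "i \<le> j \<Longrightarrow> start i \<le> start j"
  unfolding start_def by (rule sum_mono2) auto

lemma phase_eq:
  assumes "start i < n" "n \<le> start (Suc i)"
  shows "phase n = i"
  unfolding phase_def
proof (rule Least_equality)
  show "i \<le> j" if "n \<le> start (Suc j)" for j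
    using that assms(1) start_mono[of "Suc j" i] by (cases "i \<le> j") auto
qed (rule assms(2))

lemma region_subset: "region i hs \<subseteq> cball 0 (2 ^ i)"
  by (auto simp: region_def)

lemma position_hunt: "position hunt h k = target (map h [0..<k])"
proof (induction k)
  case 0
  show ?case by (simp add: position_def target_def)
next
  case (Suc k)
  then show ?case by (simp add: position_def move_def hunt_def)
qed

section \<open>The trajectory for a fixed sequence of hints\<close>

context
  fixes h :: "nat \<Rightarrow> complex set"
  assumes hints: "\<And>k. \<exists>\<theta>\<le>pi. is_angle (position hunt h k) \<theta> (h k)"
begin

text \<open>This set may be empty while \<open>2 ^ i\<close> is too small a guess; the cost bounds
  below cover that case as well.\<close>

definition known :: "nat \<Rightarrow> nat \<Rightarrow> complex set" where
  "known i k = region i (map h [0..<k])"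

lemma known_subset: "known i k \<subseteq> cball 0 (2 ^ i)"
  by (simp add: known_def region_subset)

lemma known_Suc: "known i (Suc k) = known i k \<inter> h k"
  by (auto simp: known_def region_def)

lemma known_antimono: "k \<le> l \<Longrightarrow> known i l \<subseteq> known i k"
  by (auto simp: known_def region_def)

lemma position_steiner:
  assumes "start i < n" "n \<le> start i + steps i"
  shows "position hunt h n = steiner (resolution i) (2 ^ i) (known i n)"
proof -
  have "phase n = i" using assms by (intro phase_eq) (auto simp: start_Suc)
  then show ?thesis using assms by (auto simp: position_hunt target_def Let_def known_def)
qed

lemma position_sweep_begin:
  "position hunt h (start i + steps i + 1) =
     sweep_end (- (2 ^ i)) (resolution i) (2 ^ i) (known i (start i + steps i + 1))"
proof -
  have "phase (start i + steps i + 1) = i" by (intro phase_eq) (auto simp: start_Suc)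
  then show ?thesis by (auto simp: position_hunt target_def Let_def known_def)
qed

lemma position_sweep_end:
  "position hunt h (start (Suc i)) =
     sweep_end (2 ^ i) (resolution i) (2 ^ i) (known i (start i + steps i + 1))"
proof -
  have "phase (start i + steps i + 2) = i" by (intro phase_eq) (auto simp: start_Suc)
  moreover have "map h [0..<start i + steps i + 2] =
      map h [0..<start i + steps i + 1] @ [h (start i + steps i + 1)]"
    by simp
  then have "butlast (map h [0..<start i + steps i + 2]) = map h [0..<start i + steps i + 1]"
    by (simp only: butlast_snoc)
  ultimately show ?thesis
    by (simp add: position_hunt target_def Let_def known_def start_Suc del: upt_Suc)
qed

text \<open>If no direction were thin at the end, none would be earlier in the phase, by
  antimonotonicity. Every hint at a Steiner point would then lower the support sum, more often than
  its range allows.\<close>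

lemma known_thin: "\<exists>u. thin (resolution i) (2 ^ i) (known i (start i + steps i + 1)) u"
proof (rule ccontr)
  define m where "m = resolution i"
  define R :: real where "R = 2 ^ i"
  define e where "e = start i + steps i + 1"
  assume "\<not> ?thesis"
  then have nt: "\<not> thin m R (known i e) u" for u
    by (simp add: m_def R_def e_def)
  have m: "m > 0" "real m = 96 * R" "R \<ge> 1"
    by (auto simp: m_def R_def resolution_def)
  have sub: "known i n \<subseteq> cball 0 R" for n using known_subset R_def by simp
  \<comment> \<open>On the empty set the support function is \<open>- R\<close> in every direction,
    so the width condition holds trivially.\<close>
  have ne: "known i e \<noteq> {}"
  proof
    assume "known i e = {}"
    then have "thin m R (known i e) 1"
      using m(3) by (simp add: thin_def dirs_def supp_def)
    then show False using nt by blast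
  qed
  define H where "H n = (\<Sum>z\<in>dirs m. supp R (known i n) z)" for n
  \<comment> \<open>Position \<open>start i\<close> itself is excluded: it is the end of the
    preceding phase or the origin, not a Steiner point of this phase.\<close>
  have step: "H (Suc n) \<le> H n - 1 / (16 * real m)" if n: "start i < n" "n < e" for n
  proof -
    obtain \<theta> where \<theta>: "\<theta> \<le> pi" "is_angle (position hunt h n) \<theta> (h n)"
      using hints by blast
    obtain v where v: "norm v = 1" "\<And>x. x \<in> h n \<Longrightarrow> inner (x - position hunt h n) v \<le> 0"
      using is_angle_half_plane[OF \<theta>(2,1)] by blast
    have pos: "position hunt h n = steiner m R (known i n)"
      using position_steiner[of i n] n by (simp add: e_def m_def R_def)
    have wide: "supp R (known i n) u + supp R (known i n) (- u) > 2" if "u \<in> dirs m" for u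
    proof -
      have "\<not> thin m R (known i n) u"
        using nt thin_antimono[OF m(1) sub known_antimono] n by (meson less_imp_le)
      then show ?thesis using that by (simp add: thin_def)
    qed
    show ?thesis
      unfolding H_def
    proof (rule steiner_cut[OF sub m(3) _ wide _ _ v(1)])
      show "known i (Suc n) \<noteq> {}" using ne known_antimono[of "Suc n" e i] n by auto
    qed (use m v(2) pos in \<open>auto simp: known_Suc\<close>)
  qed
  have "H (start i + 1 + j) \<le> H (start i + 1) - real j * (1 / (16 * real m))" if "j \<le> steps i" for j
    using that
  proof (induction j)
    case (Suc j)
    then show ?case using step[of "start i + 1 + j"] by (simp add: e_def algebra_simps add_divide_distrib)
  qed simp
  from this[of "steps i"]
  have "real (steps i) * (1 / (16 * real m)) \<le> H (start i + 1) - H e"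
    by (simp add: e_def)
  also have "\<dots> \<le> 8 * real m ^ 2 * R"
    using sum_supp_bounds[OF m(1) sub, of "start i + 1"] sum_supp_bounds[OF m(1) sub, of e] m(3)
    by (simp add: H_def)
  finally have "real (steps i) \<le> 8 * real m ^ 2 * R * (16 * real m)"
    using m(1) by (simp add: field_simps)
  moreover have "real (steps i) = 128 * R * real m ^ 3 + 1"
    by (simp add: steps_def m_def R_def)
  ultimately show False by (simp add: power3_eq_cube power2_eq_square)
qed

lemma norm_position_le:
  assumes "start i < n" "n \<le> start (Suc i)"
  shows "norm (position hunt h n) \<le> 2 * 2 ^ i"
proof -
  consider "n \<le> start i + steps i" | "n = start i + steps i + 1" | "n = start (Suc i)"
    using assms unfolding start_Suc by linarith
  then show ?thesis
  proof cases
    case 1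
    then show ?thesis
      using assms by (simp add: position_steiner norm_steiner_le resolution_pos known_subset)
  next
    case 2
    show ?thesis
      unfolding 2 position_sweep_begin
      by (intro norm_sweep_end_le known_thin known_subset resolution_pos) auto
  next
    case 3
    show ?thesis
      unfolding 3 position_sweep_end
      by (intro norm_sweep_end_le known_thin known_subset resolution_pos) auto
  qed
qed

lemma norm_position_start_le: "norm (position hunt h (start i)) \<le> 2 * 2 ^ i"
proof (cases i)
  case 0
  then show ?thesis by (simp add: start_def position_def)
next
  case (Suc j)
  have "norm (position hunt h (start (Suc j))) \<le> 2 * 2 ^ j"
    by (intro norm_position_le) (auto simp: start_Suc)
  also have "\<dots> \<le> 2 * 2 ^ i" by (simp add: Suc)
  finally show ?thesis by (simp add: Suc)
qed

lemma move_eq: "move A h k = position A h (Suc k) - position A h k"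
  by (simp add: position_def)

lemma norm_move_le:
  assumes "start i \<le> k" "k < start (Suc i)"
  shows "norm (move hunt h k) \<le> 4 * 2 ^ i"
proof -
  have "norm (position hunt h k) \<le> 2 * 2 ^ i"
    using assms norm_position_le[of i k] norm_position_start_le[of i] by (cases "k = start i") auto
  moreover have "norm (position hunt h (Suc k)) \<le> 2 * 2 ^ i"
    using assms by (intro norm_position_le) auto
  ultimately show ?thesis
    unfolding move_eq using norm_triangle_ineq4[of "position hunt h (Suc k)" "position hunt h k"] by linarith
qed

text \<open>The moves between Steiner points telescope to at most \<open>4 * 2 ^ i\<close>, whatever
  their number. Entering the phase, reaching the sweep and sweeping cost at most
  \<open>4 * 2 ^ i\<close> each.\<close>

lemma phase_cost: "(\<Sum>k = start i..<start (Suc i). norm (move hunt h k)) \<le> 16 * 2 ^ i"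
proof -
  define m where "m = resolution i"
  define R :: real where "R = 2 ^ i"
  have m: "m > 0" "R \<ge> 1" by (auto simp: m_def R_def resolution_def)
  have sub: "known i n \<subseteq> cball 0 R" for n using known_subset R_def by simp
  define H where "H n = (\<Sum>z\<in>dirs m. supp R (known i n) z)" for n
  define a where "a = start i + 1"
  define b where "b = start i + steps i"
  have ab: "start i < a" "a \<le> b" "b \<le> start (Suc i)" by (auto simp: a_def b_def steps_def start_Suc)
  have "(\<Sum>k = a..<b. norm (move hunt h k)) \<le> (\<Sum>k = a..<b. (- H (Suc k) - - H k) / (2 * real m ^ 2))"
  proof (rule sum_mono)
    fix k assume k: "k \<in> {a..<b}"
    have "norm (move hunt h k) = norm (steiner m R (known i (Suc k)) - steiner m R (known i k))"
      unfolding move_eq using position_steiner[of i k] position_steiner[of i "Suc k"] k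
      by (simp add: a_def b_def m_def R_def)
    also have "\<dots> \<le> (H k - H (Suc k)) / (2 * real m ^ 2)"
      unfolding H_def by (intro norm_steiner_diff_le m sub known_antimono) auto
    finally show "norm (move hunt h k) \<le> (- H (Suc k) - - H k) / (2 * real m ^ 2)" by simp
  qed
  also have "\<dots> = (H a - H b) / (2 * real m ^ 2)"
    using sum_Suc_diff'[of a b "\<lambda>k. - H k"] ab by (simp flip: sum_divide_distrib)
  also have "\<dots> \<le> (8 * real m ^ 2 * R) / (2 * real m ^ 2)"
    using sum_supp_bounds[OF m(1) sub, of a] sum_supp_bounds[OF m(1) sub, of b] m(2)
    by (intro divide_right_mono) (auto simp: H_def)
  also have "\<dots> = 4 * 2 ^ i" using m by (simp add: R_def)
  finally have 1: "(\<Sum>k = a..<b. norm (move hunt h k)) \<le> 4 * 2 ^ i" .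
  have "(\<Sum>k = start i..<start (Suc i). norm (move hunt h k)) =
      norm (move hunt h (start i)) + (\<Sum>k = a..<b. norm (move hunt h k))
        + norm (move hunt h b) + norm (move hunt h (Suc b))"
  proof -
    have "start (Suc i) = Suc (Suc b)" by (simp add: start_Suc b_def)
    then show ?thesis
      using ab by (simp add: sum.atLeast_Suc_lessThan[of "start i"] a_def)
  qed
  moreover have "norm (move hunt h (start i)) \<le> 4 * 2 ^ i" "norm (move hunt h b) \<le> 4 * 2 ^ i"
    "norm (move hunt h (Suc b)) \<le> 4 * 2 ^ i"
    by (intro norm_move_le; simp add: b_def start_Suc)+
  ultimately show ?thesis using 1 by linarith
qed

text \<open>Phase costs are dominated by a geometric series, so doubling the guess only costs a
  constant factor.\<close>

lemma total_cost: "(\<Sum>k<start i. norm (move hunt h k)) \<le> 16 * 2 ^ i"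
proof (induction i)
  case 0
  show ?case by (simp add: start_def)
next
  case (Suc i)
  have "(\<Sum>k<start (Suc i). norm (move hunt h k)) =
      (\<Sum>k<start i. norm (move hunt h k)) + (\<Sum>k = start i..<start (Suc i). norm (move hunt h k))"
    unfolding lessThan_atLeast0 by (rule sum.atLeastLessThan_concat[symmetric]) (auto simp: start_Suc)
  then show ?case using Suc phase_cost[of i] by simp
qed

lemma hunt_finds:
  assumes D: "D > 1" "dist 0 t \<le> D" and t: "\<And>k. t \<in> h k"
  shows "finds_within hunt h t (64 * D)"
proof -
  define i where "i = (LEAST i. D \<le> 2 ^ i)"
  have "\<exists>i. D \<le> 2 ^ i"
    using real_arch_pow[of 2 D] less_imp_le by fastforce
  then have i: "D \<le> 2 ^ i" unfolding i_def by (rule LeastI_ex)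
  \<comment> \<open>\<open>D > 1\<close> rules out \<open>i = 0\<close>, so minimality of
    \<open>i\<close> can be applied to its predecessor and yields
    \<open>2 ^ i \<le> 2 * D\<close>.\<close>
  obtain j where j: "i = Suc j" using i D(1) by (cases i) auto
  have "\<not> D \<le> 2 ^ j" using not_less_Least[of j "\<lambda>i. D \<le> 2 ^ i"] j i_def by auto
  then have i2: "2 ^ i \<le> 2 * D" by (simp add: j)
  \<comment> \<open>Move \<open>k\<close> is the sweep of phase \<open>i\<close>, the last move of
    that phase.\<close>
  define k where "k = start i + steps i + 1"
  have "t \<in> known i k"
    using t D(2) i by (auto simp: known_def region_def)
  then obtain q where q: "q \<in> closed_segment (position hunt h k) (position hunt h (Suc k))" "dist q t \<le> 1"
    using sweep_finds[OF resolution_pos known_subset _ known_thin] position_sweep_begin[of i]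
      position_sweep_end[of i] unfolding k_def start_Suc by auto
  have "dist (position hunt h k) q \<le> norm (move hunt h k)"
    using segment_bound(1)[OF q(1)] by (simp add: move_eq dist_norm norm_minus_commute)
  then have "(\<Sum>l<k. norm (move hunt h l)) + dist (position hunt h k) q \<le> (\<Sum>l<Suc k. norm (move hunt h l))"
    by simp
  also have "\<dots> = (\<Sum>l<start (Suc i). norm (move hunt h l))"
    by (simp add: k_def start_Suc)
  also have "\<dots> \<le> 16 * 2 ^ Suc i" by (rule total_cost)
  also have "\<dots> \<le> 64 * D" using i2 by simp
  finally show ?thesis
    unfolding finds_within_def using q by blast
qed

end

theorem theorem1:
  shows "\<exists>(A :: algorithm) (C :: real). C > 0 \<and>
    (\<forall>(D :: real) (t :: complex) (h :: nat \<Rightarrow> complex set).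
       D > 1 \<longrightarrow> dist 0 t \<le> D \<longrightarrow> consistent_hints pi A t h \<longrightarrow>
       finds_within A h t (C * D))"
proof (intro exI[of _ hunt] exI[of _ "64 :: real"] conjI allI impI)
  fix D :: real and t :: complex and h :: "nat \<Rightarrow> complex set"
  assume "D > 1" "dist 0 t \<le> D" "consistent_hints pi hunt t h"
  then show "finds_within hunt h t (64 * D)"
    by (intro hunt_finds) (auto simp: consistent_hints_def)
qed simp

end
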